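(* The two-dimensional subalgebras of ${\rm A}_2$ are exactly $\langle e_1,e_2\rangle$ and $\langle e_2,e_3\rangle$; up to automorphisms of ${\rm A}_2$ every two-dimensional subalgebra is equivalent to $\langle e_1,e_2\rangle$ or $\langle e_2,e_3\rangle$.
   Context: ${\rm A}_2$ is the complex algebra with basis $e_1,e_2,e_3$, unit $e_1$ ($e_1e_i=e_ie_1=e_i$), and $e_3e_3=e_2$; all other products of basis elements are zero. A subalgebra is a linear subspace closed under multiplication (it need not contain $e_1$). Equivalence up to automorphisms means one is mapped onto the other by an algebra automorphism. $\langle S\rangle$ denotes linear span. *)

theory Defs
  imports "HOL-Analysis.Analysis"
begin

text \<open>The algebra A2 is modelled on the complex vector space complex^3, coordinates
  taken w.r.t. the basis e1, e2, e3 (= axis 1 1, axis 2 1, axis 3 1).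
  Linear-algebra notions are the complex ones (vec.subspace, vec.span, vec.dim, complex-linear maps).\<close>

definition A2_e1 :: "complex ^ 3" where "A2_e1 = axis 1 1"
definition A2_e2 :: "complex ^ 3" where "A2_e2 = axis 2 1"
definition A2_e3 :: "complex ^ 3" where "A2_e3 = axis 3 1"

text \<open>Bilinear extension of e1 ei = ei e1 = ei, e3 e3 = e2, other basis products 0.\<close>
definition A2_mult :: "complex ^ 3 \<Rightarrow> complex ^ 3 \<Rightarrow> complex ^ 3" where
  "A2_mult x y = vector [x$1 * y$1,
                         x$1 * y$2 + x$2 * y$1 + x$3 * y$3,
                         x$1 * y$3 + x$3 * y$1]"

definition A2_subalgebra :: "(complex ^ 3) set \<Rightarrow> bool" where
  "A2_subalgebra S \<longleftrightarrow> vec.subspace S \<and> (\<forall>x\<in>S. \<forall>y\<in>S. A2_mult x y \<in> S)"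

definition A2_automorphism :: "(complex ^ 3 \<Rightarrow> complex ^ 3) \<Rightarrow> bool" where
  "A2_automorphism f \<longleftrightarrow> Vector_Spaces.linear ((*s)) ((*s)) f \<and> bij f \<and>
     (\<forall>x y. f (A2_mult x y) = A2_mult (f x) (f y))"

end

theory Submission
  imports Defs
begin

text \<open>Write \<open>x = x\<^sub>1 e\<^sub>1 + x\<^sub>2 e\<^sub>2 + x\<^sub>3 e\<^sub>3\<close>. The planes \<open>x\<^sub>3 = 0\<close> and
  \<open>x\<^sub>1 = 0\<close>, i.e. \<open>\<langle>e\<^sub>1,e\<^sub>2\<rangle>\<close> and \<open>\<langle>e\<^sub>2,e\<^sub>3\<rangle>\<close>, are subalgebras. Conversely, a subalgebra
  lying in neither plane contains some \<open>u\<close> with \<open>u\<^sub>1 \<noteq> 0\<close>; normalised, \<open>u = e\<^sub>1 + n\<close> with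
  \<open>n\<^sup>3 = 0\<close>, so \<open>e\<^sub>1 = 3u - 3u\<^sup>2 + u\<^sup>3\<close> lies in it. It also contains some \<open>x\<close> with
  \<open>x\<^sub>3 \<noteq> 0\<close>, and \<open>y = x - x\<^sub>1 e\<^sub>1\<close> has \<open>y\<^sup>2 = x\<^sub>3\<^sup>2 e\<^sub>2\<close>, which then yields \<open>e\<^sub>2\<close> and \<open>e\<^sub>3\<close>:
  the subalgebra is three-dimensional. Hence the two planes are the only two-dimensional
  subalgebras, and the identity automorphism suffices for the second claim.\<close>

lemma span_axis_cart:
  "vec.span ((\<lambda>i. axis i 1) ` d) = {x::'a::field^'n. \<forall>i. i \<notin> d \<longrightarrow> x $ i = 0}"
  (is "vec.span ?B = ?A")
proof
  show "vec.span ?B \<subseteq> ?A"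
    by (rule vec.span_minimal) (auto simp: subspace_substandard_cart axis_def)
  show "?A \<subseteq> vec.span ?B"
  proof
    fix x
    assume "x \<in> ?A"
    then have "x = (\<Sum>i\<in>d. x $ i *s axis i 1)"
      by (subst basis_expansion[symmetric]) (auto intro: sum.mono_neutral_cong_right)
    also have "\<dots> \<in> vec.span ?B"
      by (intro vec.span_sum vec.span_scale vec.span_base) auto
    finally show "x \<in> vec.span ?B" .
  qed
qed

lemma dim_coordinate_hyperplane_cart:
  "vec.dim {x::'a::field^'n. x $ k = 0} = CARD('n) - 1"
proof -
  have "{x::'a^'n. x $ k = 0} = {x. \<forall>i. i \<notin> UNIV - {k} \<longrightarrow> x $ i = 0}"
    by auto
  moreover have "card (UNIV - {k}) = CARD('n) - 1"
    by (simp add: card_Diff_singleton)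
  ultimately show ?thesis
    by (simp only: dim_substandard_cart)
qed

lemma subspace_coordinate_hyperplane_cart: "vec.subspace {x::'a::field^'n. x $ k = 0}"
  by (auto simp: vec.subspace_def)

lemma A2_basis_component [simp]:
  "A2_e1 $ 1 = 1" "A2_e1 $ 2 = 0" "A2_e1 $ 3 = 0"
  "A2_e2 $ 1 = 0" "A2_e2 $ 2 = 1" "A2_e2 $ 3 = 0"
  "A2_e3 $ 1 = 0" "A2_e3 $ 2 = 0" "A2_e3 $ 3 = 1"
  by (simp_all add: A2_e1_def A2_e2_def A2_e3_def axis_def)

lemma A2_mult_component [simp]:
  "A2_mult x y $ 1 = x$1 * y$1"
  "A2_mult x y $ 2 = x$1 * y$2 + x$2 * y$1 + x$3 * y$3"
  "A2_mult x y $ 3 = x$1 * y$3 + x$3 * y$1"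
  by (simp_all add: A2_mult_def)

lemma span_A2_e1_e2: "vec.span {A2_e1, A2_e2} = {x. x $ 3 = 0}"
proof -
  have "{A2_e1, A2_e2} = (\<lambda>i. axis i 1) ` {1, 2}"
    by (simp add: A2_e1_def A2_e2_def)
  moreover have "{x::complex^3. \<forall>i. i \<notin> {1, 2} \<longrightarrow> x $ i = 0} = {x. x $ 3 = 0}"
    by (auto simp: forall_3)
  ultimately show ?thesis
    by (simp only: span_axis_cart)
qed

lemma span_A2_e2_e3: "vec.span {A2_e2, A2_e3} = {x. x $ 1 = 0}"
proof -
  have "{A2_e2, A2_e3} = (\<lambda>i. axis i 1) ` {2, 3}"
    by (simp add: A2_e2_def A2_e3_def)
  moreover have "{x::complex^3. \<forall>i. i \<notin> {2, 3} \<longrightarrow> x $ i = 0} = {x. x $ 1 = 0}"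
    by (auto simp: forall_3)
  ultimately show ?thesis
    by (simp only: span_axis_cart)
qed

lemma A2_subalgebra_coordinate_hyperplanes:
  "A2_subalgebra {x. x $ 3 = 0}" "A2_subalgebra {x. x $ 1 = 0}"
  by (auto simp: A2_subalgebra_def subspace_coordinate_hyperplane_cart)

lemma A2_subalgebra_closed:
  assumes "A2_subalgebra S" "x \<in> S" "y \<in> S"
  shows "x + y \<in> S" "c *s x \<in> S" "A2_mult x y \<in> S"
  using assms by (auto simp: A2_subalgebra_def intro: vec.subspace_add vec.subspace_scale)

lemma A2_subalgebra_contains_e1:
  assumes S: "A2_subalgebra S" and u: "u \<in> S" "u $ 1 \<noteq> 0"
  shows "A2_e1 \<in> S"
proof -
  define w where "w = inverse (u $ 1) *s u"
  have "w \<in> S" "w $ 1 = 1"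
    using u A2_subalgebra_closed[OF S] by (auto simp: w_def)
  then have "3 *s w + (-3) *s A2_mult w w + A2_mult (A2_mult w w) w \<in> S"
    using A2_subalgebra_closed[OF S] by meson
  also have "3 *s w + (-3) *s A2_mult w w + A2_mult (A2_mult w w) w = A2_e1"
    using \<open>w $ 1 = 1\<close> by (simp add: vec_eq_iff forall_3 algebra_simps)
  finally show ?thesis .
qed

lemma A2_subalgebra_eq_UNIV:
  assumes S: "A2_subalgebra S" and e1: "A2_e1 \<in> S" and x: "x \<in> S" "x $ 3 \<noteq> 0"
  shows "S = UNIV"
proof -
  note closed = A2_subalgebra_closed[OF S]
  define y where "y = x + (- x $ 1) *s A2_e1"
  have "y \<in> S"
    unfolding y_def using x e1 closed by blast
  have y: "y $ 1 = 0" "y $ 2 = x $ 2" "y $ 3 = x $ 3"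
    by (simp_all add: y_def)
  have "inverse ((x $ 3)\<^sup>2) *s A2_mult y y \<in> S"
    using \<open>y \<in> S\<close> closed by blast
  also have "inverse ((x $ 3)\<^sup>2) *s A2_mult y y = A2_e2"
    using x(2) y by (simp add: vec_eq_iff forall_3 power2_eq_square field_simps)
  finally have e2: "A2_e2 \<in> S" .
  have "inverse (x $ 3) *s (y + (- x $ 2) *s A2_e2) \<in> S"
    using \<open>y \<in> S\<close> e2 closed by blast
  also have "inverse (x $ 3) *s (y + (- x $ 2) *s A2_e2) = A2_e3"
    using x(2) y by (simp add: vec_eq_iff forall_3 field_simps)
  finally have e3: "A2_e3 \<in> S" .
  have "range (\<lambda>i::3. axis i (1::complex)) = {A2_e1, A2_e2, A2_e3}"
    by (simp add: UNIV_3 A2_e1_def A2_e2_def A2_e3_def)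
  then have "vec.span {A2_e1, A2_e2, A2_e3} = UNIV"
    using span_axis_cart[where d = UNIV and 'a = complex and 'n = 3] by simp
  moreover have "vec.span {A2_e1, A2_e2, A2_e3} \<subseteq> S"
    using S e1 e2 e3 by (intro vec.span_minimal) (auto simp: A2_subalgebra_def)
  ultimately show ?thesis
    by blast
qed

lemma A2_subalgebra_cases:
  assumes "A2_subalgebra S"
  shows "S \<subseteq> {x. x $ 1 = 0} \<or> S \<subseteq> {x. x $ 3 = 0} \<or> S = UNIV"
  using assms A2_subalgebra_contains_e1 A2_subalgebra_eq_UNIV by blast

lemma A2_subalgebra_dim_2_iff:
  "A2_subalgebra S \<and> vec.dim S = 2 \<longleftrightarrow>
     S = vec.span {A2_e1, A2_e2} \<or> S = vec.span {A2_e2, A2_e3}"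
proof
  assume S: "A2_subalgebra S \<and> vec.dim S = 2"
  then have "vec.subspace S"
    by (simp add: A2_subalgebra_def)
  have "vec.dim {x::complex^3. x $ k = 0} = 2" for k
    by (simp add: dim_coordinate_hyperplane_cart)
  then have plane: "S = {x. x $ k = 0}" if "S \<subseteq> {x. x $ k = 0}" for k
    using vec.subspace_dim_equal[OF \<open>vec.subspace S\<close> subspace_coordinate_hyperplane_cart that] S
    by simp
  have "S \<noteq> UNIV"
    using S vec_dim_card[where 'a = complex and 'n = 3] by auto
  then have "S = {x. x $ 3 = 0} \<or> S = {x. x $ 1 = 0}"
    using A2_subalgebra_cases S plane by blast
  then show "S = vec.span {A2_e1, A2_e2} \<or> S = vec.span {A2_e2, A2_e3}"
    by (simp add: span_A2_e1_e2 span_A2_e2_e3)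
next
  assume "S = vec.span {A2_e1, A2_e2} \<or> S = vec.span {A2_e2, A2_e3}"
  then show "A2_subalgebra S \<and> vec.dim S = 2"
    by (auto simp: span_A2_e1_e2 span_A2_e2_e3 A2_subalgebra_coordinate_hyperplanes
        dim_coordinate_hyperplane_cart)
qed

lemma A2_automorphism_id: "A2_automorphism id"
  by (simp add: A2_automorphism_def vec.linear_id)

theorem mainTheorem7:
  shows "(\<forall>S. (A2_subalgebra S \<and> vec.dim S = 2) \<longleftrightarrow>
              (S = vec.span {A2_e1, A2_e2} \<or> S = vec.span {A2_e2, A2_e3}))
       \<and> (\<forall>S. A2_subalgebra S \<and> vec.dim S = 2 \<longrightarrow>
              (\<exists>f. A2_automorphism f \<and>
                   (f ` S = vec.span {A2_e1, A2_e2} \<or> f ` S = vec.span {A2_e2, A2_e3})))"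
proof (intro conjI allI impI)
  fix S :: "(complex^3) set"
  show "A2_subalgebra S \<and> vec.dim S = 2 \<longleftrightarrow>
          S = vec.span {A2_e1, A2_e2} \<or> S = vec.span {A2_e2, A2_e3}"
    by (rule A2_subalgebra_dim_2_iff)
  assume "A2_subalgebra S \<and> vec.dim S = 2"
  then show "\<exists>f. A2_automorphism f \<and>
               (f ` S = vec.span {A2_e1, A2_e2} \<or> f ` S = vec.span {A2_e2, A2_e3})"
    using A2_subalgebra_dim_2_iff A2_automorphism_id by (intro exI[of _ id]) auto
qed

end
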